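(* With $\Lambda(\mathcal{P}_i)$ denoting the spectrum of the power property $\mathcal{P}_i$ (a set of pairs $(\omega,p)$), one has: (1) $\Lambda(\mathcal{P}_1)=(\mathrm{T}1.2\times\Gamma_b)\sqcup(\mathrm{T}1.3\times\Gamma_a)$; (2) $\Lambda(\mathcal{P}_2)=\mathrm{T}1.3\times\Gamma_{aa}$; (3) $\Lambda(\mathcal{P}_1)\setminus\Lambda(\mathcal{P}_2)=(\mathrm{T}1.2\times\Gamma_b)\sqcup(\mathrm{T}1.3\times\Gamma_{ab})$; (4) $\Lambda(\mathcal{P}_i)=\emptyset$ for all $i\ge3$. Here $\sqcup$ denotes disjoint union.
   Context: Words are over $\{a,b\}$; $\varepsilon$ is the empty word, $|\omega|$ the length. Let $\sigma(a)=ab$, $\sigma(b)=a$, $F_k=\sigma^k(a)$ for $k\ge0$, and $F_\infty=\lim_{k\to\infty}F_k$ (Fibonacci sequence), with $F_\infty[p]$ its $p$-th letter, $p\in\mathbb{N}=\{1,2,\dots\}$. Let $f_{-1}=f_0=1$, $f_{k+1}=f_k+f_{k-1}$, so $|F_k|=f_k$. For $k\ge0$ let $\alpha$ be the last letter of $F_k$ and $\beta$ the other letter; the singular words are $s_{-1}=a$ and $s_k=\beta F_k\alpha^{-1}$ for $k\ge0$ (delete the last letter of $F_k$ and prepend $\beta$). Throughout, $\omega$ ranges over the factors of $F_\infty$ with $\omega\notin\{\varepsilon,ab,ba,aba\}$; for such $\omega$ the singular kernel $sk(\omega)$, the longest singular word that is a factor of $\omega$, is well defined. Types: for such $\omega$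 let $k\ge0$ be the unique integer with $f_k\le|\omega|<f_{k+1}$. Then $\omega\in\mathrm{T}1.j$ iff $|\omega|=f_k$ and $sk(\omega)=s_{k-j+1}$, and $\omega\in\mathrm{T}2.j$ iff $f_k<|\omega|<f_{k+1}$ and $sk(\omega)=s_{k-j+1}$, for $j=1,2,3$ (for $j=3$ only $k\ge1$ is considered). $\omega_p$ denotes the $p$-th occurrence of $\omega$ in $F_\infty$ ($p\ge1$). Write $\omega_p\in\mathcal{P}_i$ ($i\ge1$) if the $i+1$ consecutive occurrences $\omega_p,\omega_{p+1},\dots,\omega_{p+i}$ are successively adjacent, i.e. for each $0\le t<i$ the occurrence $\omega_{p+t+1}$ begins at the position immediately after the end of $\omega_{p+t}$. The spectrum is $\Lambda(\mathcal{P}_i)=\{(\omega,p): p\in\mathbb{N},\ \omega_p\in\mathcal{P}_i\}$. $\Gamma_a=\{p: F_\infty[p]=a\}$, $\Gamma_b=\{p:F_\infty[p]=b\}$, $\Gamma_{aa}=\{p:F_\infty[p]=F_\infty[p+1]=a\}$, $\Gamma_{ab}=\{p:F_\infty[p]=a,\ F_\infty[p+1]=b\}$. *)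

theory Defs
  imports Complex_Main "HOL-Library.Sublist" "HOL-Library.Infinite_Set" "HOL-Number_Theory.Fib"
begin

datatype letter = La | Lb

type_synonym word = "letter list"

fun other_letter :: "letter \<Rightarrow> letter" where
  "other_letter La = Lb"
| "other_letter Lb = La"

fun sigma_letter :: "letter \<Rightarrow> word" where
  "sigma_letter La = [La, Lb]"
| "sigma_letter Lb = [La]"

definition sigma :: "word \<Rightarrow> word" where
  "sigma w = concat (map sigma_letter w)"

definition fib_word :: "nat \<Rightarrow> word" where
  "fib_word k = (sigma ^^ k) [La]"

text \<open>The numbers $f_k$ are normalised by $f_{-1} = f_0 = 1$; the library has
  \<open>fib 1 = fib 2 = 1\<close>, hence the shift by two.\<close>

definition fib_len :: "nat \<Rightarrow> nat" where
  "fib_len k = fib (k + 2)"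

lemma fib_len_rec: "fib_len 0 = 1" "fib_len (Suc 0) = 1 + 1"
    "fib_len (Suc (Suc k)) = fib_len (Suc k) + fib_len k"
  by (simp_all add: fib_len_def numeral_eq_Suc)

text \<open>The limit is letterwise: the letter at position \<open>p\<close> is the one found there in all
  sufficiently late \<open>fib_word k\<close>. Positions start at 1; position 0 is never used.\<close>

definition fib_inf :: "nat \<Rightarrow> letter" where
  "fib_inf p = (THE c. \<forall>\<^sub>F k in sequentially.
      p \<le> length (fib_word k) \<and> fib_word k ! (p - 1) = c)"

definition occurrences :: "word \<Rightarrow> nat set" where
  "occurrences w = {q. 1 \<le> q \<and> map fib_inf [q..<q + length w] = w}"

text \<open>Start position of the \<open>p\<close>-th occurrence, \<open>p \<ge> 1\<close>. The library's \<^const>\<open>enumerate\<close>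
  counts from 0 and is meaningful for infinite sets; every factor of the Fibonacci sequence
  does occur infinitely often.\<close>

definition occ :: "word \<Rightarrow> nat \<Rightarrow> nat" where
  "occ w p = enumerate (occurrences w) (p - 1)"

definition admissible_factors :: "word set" where
  "admissible_factors =
     {w. occurrences w \<noteq> {} \<and> w \<notin> {[], [La, Lb], [Lb, La], [La, Lb, La]}}"

text \<open>Singular words are indexed by the integers \<open>k \<ge> -1\<close>; the value at \<open>k < -1\<close> is junk
  and is excluded from \<open>singular_words\<close>.\<close>

definition singular :: "int \<Rightarrow> word" where
  "singular k = (if k < 0 then [La]
     else other_letter (last (fib_word (nat k))) # butlast (fib_word (nat k)))"

definition singular_words :: "word set" where
  "singular_words = {singular k | k. -1 \<le> k}"

definition singular_kernel :: "word \<Rightarrow> word" where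
  "singular_kernel w = (THE s. s \<in> singular_words \<and> sublist s w \<and>
      (\<forall>t \<in> singular_words. sublist t w \<longrightarrow> length t \<le> length s))"

definition T1 :: "nat \<Rightarrow> word set" where
  "T1 j = {w \<in> admissible_factors. \<exists>k. fib_len k \<le> length w \<and> length w < fib_len (k + 1) \<and>
      length w = fib_len k \<and> (j = 3 \<longrightarrow> 1 \<le> k) \<and>
      singular_kernel w = singular (int k - int j + 1)}"

definition power_property :: "nat \<Rightarrow> word \<Rightarrow> nat \<Rightarrow> bool" where
  "power_property i w p \<longleftrightarrow> (\<forall>t<i. occ w (p + t + 1) = occ w (p + t) + length w)"

definition spectrum :: "(word \<Rightarrow> nat \<Rightarrow> bool) \<Rightarrow> (word \<times> nat) set" where
  "spectrum P = {(w, p). w \<in> admissible_factors \<and> 1 \<le> p \<and> P w p}"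

definition Gamma_a :: "nat set" where
  "Gamma_a = {p. 1 \<le> p \<and> fib_inf p = La}"

definition Gamma_b :: "nat set" where
  "Gamma_b = {p. 1 \<le> p \<and> fib_inf p = Lb}"

definition Gamma_aa :: "nat set" where
  "Gamma_aa = {p. 1 \<le> p \<and> fib_inf p = La \<and> fib_inf (p + 1) = La}"

definition Gamma_ab :: "nat set" where
  "Gamma_ab = {p. 1 \<le> p \<and> fib_inf p = La \<and> fib_inf (p + 1) = Lb}"

end

theory Submission
  imports Defs "HOL-Library.Multiset"
begin

text \<open>
The Fibonacci sequence is a fixed point of \<open>\<sigma>\<close>, so for each \<open>n\<close> it is cut into blocks
\<open>\<sigma>\<^sup>n(a)\<close> and \<open>\<sigma>\<^sup>n(b)\<close>, of lengths \<open>f\<^sub>n\<close> and \<open>f\<^bsub>n-1\<^esub>\<close>, and the \<open>p\<close>-th block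
is determined by the \<open>p\<close>-th letter. The proof shows that the occurrences of any factor follow these
blocks: if \<open>sk(\<omega>) = s\<^sub>k\<close>, then \<open>\<omega>\<^sub>p\<close> starts at a fixed offset from the start of the
\<open>p\<close>-th block of order \<open>k + 2\<close>, so that the distance from \<open>\<omega>\<^sub>p\<close> to
\<open>\<omega>\<^bsub>p+1\<^esub>\<close> is \<open>f\<^bsub>k+2\<^esub>\<close> if the \<open>p\<close>-th letter is \<open>a\<close> and
\<open>f\<^bsub>k+1\<^esub>\<close> if it is \<open>b\<close> (lemma \<open>kernel_and_gaps\<close>). The two occurrences are
adjacent iff this distance is \<open>|\<omega>|\<close>. The first value is the length of the words of type T1.3,
the second that of the words of type T1.2, which gives (1); and (2)--(4) follow because neither
\<open>bb\<close> nor \<open>aaa\<close> is a factor.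

The connection between a factor and the blocks is made by the central words \<open>c\<^sub>0 = \<epsilon>\<close>,
\<open>c\<^bsub>n+1\<^esub> = \<sigma>(c\<^sub>n)a\<close>, which are the Fibonacci words without their last two letters.
Every \<open>a\<close> starts a block of \<open>\<sigma>\<close>, so \<open>\<sigma>(u)a\<close> occurs exactly at the starts of the
blocks that come from an occurrence of \<open>u\<close>; hence \<open>c\<^sub>n\<close> occurs exactly at the starts of
the blocks of order \<open>n\<close>. Let \<open>c\<^sub>n\<close> be the shortest central word that contains
\<open>\<omega>\<close>. By desubstitution, every occurrence of \<open>\<omega>\<close> lies inside an occurrence of
\<open>c\<^sub>n\<close>, always at the same place (\<open>occurs_only_inside_central\<close>). Since
\<open>c\<^bsub>n-1\<^esub>\<close> is both a prefix and a suffix of \<open>c\<^sub>n\<close>, a factor of \<open>c\<^sub>n\<close> that is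
not a factor of \<open>c\<^bsub>n-1\<^esub>\<close> has to cover the middle of \<open>c\<^sub>n\<close>, which is the singular
word \<open>s\<^bsub>n-2\<^esub>\<close> (\<open>singular_in_factor\<close>). No later singular word fits into \<open>c\<^sub>n\<close>: by
periodicity, each window of the length of \<open>F\<^sub>m\<close> in \<open>c\<^bsub>m+1\<^esub>\<close> has the letter counts of
\<open>F\<^sub>m\<close>, whereas \<open>s\<^sub>m\<close> has one letter exchanged (\<open>singular_not_in_central\<close>). So
\<open>sk(\<omega>) = s\<^bsub>n-2\<^esub>\<close>.
\<close>

section \<open>The substitution and its fixed point\<close>

lemma sigma_simps [simp]:
  "sigma [] = []" "sigma (x # w) = sigma_letter x @ sigma w" "sigma (u @ v) = sigma u @ sigma v"
  by (simp_all add: sigma_def)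

lemma fib_word_0: "fib_word 0 = [La]"
  by (simp add: fib_word_def)

lemma fib_word_Suc: "fib_word (Suc k) = sigma (fib_word k)"
  by (simp add: fib_word_def)

lemma fib_word_Suc_Suc: "fib_word (Suc (Suc k)) = fib_word (Suc k) @ fib_word k"
proof (induction k)
  case 0
  show ?case by (simp add: fib_word_Suc fib_word_0)
next
  case (Suc k)
  have "fib_word (Suc (Suc (Suc k))) = sigma (fib_word (Suc k) @ fib_word k)"
    using Suc by (simp add: fib_word_Suc)
  then show ?case by (simp only: sigma_simps fib_word_Suc)
qed

lemma length_fib_word: "length (fib_word k) = fib_len k"
proof (induction k rule: fib.induct)
  case 1 show ?case by (simp add: fib_word_0 fib_len_rec)
next
  case 2 show ?case by (simp add: fib_word_Suc fib_word_0 fib_len_rec)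
next
  case (3 n) then show ?case by (simp add: fib_word_Suc_Suc fib_len_rec)
qed

lemma fib_len_pos: "0 < fib_len k"
  by (simp add: fib_len_def fib_neq_0_nat)

lemma fib_word_nonempty: "fib_word k \<noteq> []"
  using fib_len_pos[of k] by (simp flip: length_fib_word)

lemma le_fib_len: "k < fib_len k"
proof (induction k rule: fib.induct)
  case (3 n) then show ?case using fib_len_pos[of n] by (simp add: fib_len_rec)
qed (simp_all add: fib_len_rec)

lemma prefix_fib_word_Suc: "prefix (fib_word k) (fib_word (Suc k))"
proof (cases k)
  case 0 then show ?thesis by (simp add: fib_word_Suc fib_word_0)
next
  case (Suc j) then show ?thesis by (simp add: fib_word_Suc_Suc)
qed

lemma prefix_fib_word: "j \<le> k \<Longrightarrow> prefix (fib_word j) (fib_word k)"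
  by (induction k rule: dec_induct) (simp, metis prefix_fib_word_Suc prefix_order.trans)

lemma fib_len_mono: "j \<le> k \<Longrightarrow> fib_len j \<le> fib_len k"
  using prefix_fib_word[of j k] by (auto dest: prefix_length_le simp: length_fib_word)

lemma fib_len_less_Suc: "fib_len k < fib_len (Suc k)"
  by (cases k) (simp_all add: fib_len_rec fib_len_pos)

text \<open>Each Fibonacci word is a prefix of the next, so the letter at a position is already final in
  the first Fibonacci word that reaches it.\<close>

lemma fib_inf_eq:
  assumes "1 \<le> p" "p \<le> fib_len k"
  shows "fib_inf p = fib_word k ! (p - 1)"
proof -
  have stable: "p \<le> length (fib_word m) \<and> fib_word m ! (p - 1) = fib_word k ! (p - 1)" if km: "k \<le> m" for m
  proof -
    obtain z where z: "fib_word m = fib_word k @ z"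
      using prefix_fib_word[OF km] by (auto simp: prefix_def)
    have "p \<le> length (fib_word m)" "p - 1 < length (fib_word k)"
      using assms fib_len_mono[OF km] by (simp_all add: length_fib_word)
    then show ?thesis unfolding z by (simp add: nth_append)
  qed
  show ?thesis unfolding fib_inf_def
  proof (rule the_equality)
    show "\<forall>\<^sub>F m in sequentially. p \<le> length (fib_word m) \<and> fib_word m ! (p - 1) = fib_word k ! (p - 1)"
      unfolding eventually_sequentially using stable by blast
  next
    fix c
    assume "\<forall>\<^sub>F m in sequentially. p \<le> length (fib_word m) \<and> fib_word m ! (p - 1) = c"
    then obtain N where "\<And>m. N \<le> m \<Longrightarrow> fib_word m ! (p - 1) = c"
      by (auto simp: eventually_sequentially)
    then show "c = fib_word k ! (p - 1)"
      using stable[of "max N k"] by (metis max.cobounded1 max.cobounded2)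
  qed
qed

definition seg :: "nat \<Rightarrow> nat \<Rightarrow> word" where
  "seg q l = map fib_inf [q..<q + l]"

lemma length_seg [simp]: "length (seg q l) = l"
  by (simp add: seg_def)

lemma seg_0 [simp]: "seg q 0 = []"
  by (simp add: seg_def)

lemma seg_Suc: "seg q (Suc l) = fib_inf q # seg (Suc q) l"
  by (simp add: seg_def upt_conv_Cons del: upt_Suc)

lemma seg_add: "seg q (l + m) = seg q l @ seg (q + l) m"
  unfolding seg_def by (metis add.assoc le_add1 map_append upt_add_eq_append)

lemma in_occurrences: "q \<in> occurrences w \<longleftrightarrow> 1 \<le> q \<and> seg q (length w) = w"
  by (simp add: occurrences_def seg_def)

lemma occurrences_append:
  "q \<in> occurrences (u @ v) \<longleftrightarrow> q \<in> occurrences u \<and> q + length u \<in> occurrences v"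
  by (auto simp: in_occurrences seg_add)

lemma occurrences_Cons:
  "q \<in> occurrences (x # v) \<longleftrightarrow> 1 \<le> q \<and> fib_inf q = x \<and> Suc q \<in> occurrences v"
  by (auto simp: in_occurrences seg_Suc)

lemma occurrences_Nil [simp]: "q \<in> occurrences [] \<longleftrightarrow> 1 \<le> q"
  by (simp add: in_occurrences)

lemma fib_word_occurs_first: "1 \<in> occurrences (fib_word k)"
proof -
  have "seg 1 (fib_len k) ! i = fib_word k ! i" if "i < fib_len k" for i
    using that fib_inf_eq[of "Suc i" k] by (simp add: seg_def del: upt_Suc)
  then show ?thesis by (simp add: in_occurrences list_eq_iff_nth_eq length_fib_word)
qed

lemma prefix_occurs_first: "prefix u (fib_word k) \<Longrightarrow> 1 \<in> occurrences u"
  using fib_word_occurs_first[of k] by (auto simp: prefix_def occurrences_append)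

lemma occurs_first_unique:
  "1 \<in> occurrences u \<Longrightarrow> 1 \<in> occurrences v \<Longrightarrow> length u \<le> length v \<Longrightarrow> prefix u v"
  by (metis in_occurrences le_Suc_ex prefixI seg_add)

lemma initial_seg_prefix_fib_word: "prefix (seg 1 l) (fib_word l)"
proof -
  have "1 \<in> occurrences (seg 1 l)" by (simp add: in_occurrences)
  then show ?thesis
    using occurs_first_unique[OF _ fib_word_occurs_first] le_fib_len[of l]
    by (simp add: length_fib_word)
qed

lemma sigma_initial_seg_occurs_first: "1 \<in> occurrences (sigma (seg 1 l))"
proof -
  obtain z where "fib_word l = seg 1 l @ z"
    using initial_seg_prefix_fib_word[of l] by (auto simp: prefix_def)
  then have "prefix (sigma (seg 1 l)) (fib_word (Suc l))"
    by (simp add: fib_word_Suc)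
  then show ?thesis by (rule prefix_occurs_first)
qed

text \<open>The sequence is the concatenation of the blocks \<open>\<sigma>(x)\<close>, \<open>x\<close> running through its
  letters; this is the position of the first letter of the \<open>r\<close>-th block.\<close>

definition block_start :: "nat \<Rightarrow> nat" where
  "block_start r = Suc (length (sigma (seg 1 (r - 1))))"

lemma block_start_1 [simp]: "block_start (Suc 0) = Suc 0"
  by (simp add: block_start_def)

lemma block_start_pos [simp]: "0 < block_start r"
  by (simp add: block_start_def)

lemma block_start_add:
  assumes "1 \<le> r"
  shows "block_start (r + l) = block_start r + length (sigma (seg r l))"
proof -
  have "seg 1 (r + l - 1) = seg 1 (r - 1) @ seg r l"
    using assms seg_add[of 1 "r - 1" l] by simp
  then show ?thesis by (simp add: block_start_def)
qed

lemma block_start_Suc: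
  "1 \<le> r \<Longrightarrow> block_start (Suc r) = block_start r + length (sigma_letter (fib_inf r))"
  using block_start_add[of r 1] by (simp add: seg_Suc)

lemma sigma_seg_occurs:
  assumes "1 \<le> r"
  shows "block_start r \<in> occurrences (sigma (seg r l))"
proof -
  have "seg 1 (r - 1 + l) = seg 1 (r - 1) @ seg r l"
    using assms seg_add[of 1 "r - 1" l] by simp
  with sigma_initial_seg_occurs_first[of "r - 1 + l"]
  show ?thesis by (simp add: occurrences_append block_start_def)
qed

lemma sigma_occurs:
  "r \<in> occurrences u \<Longrightarrow> block_start r \<in> occurrences (sigma u)"
  using sigma_seg_occurs[of r "length u"] by (simp add: in_occurrences)

lemma block_letter: "1 \<le> r \<Longrightarrow> fib_inf (block_start r) = La"
  using sigma_seg_occurs[of r 1]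
  by (cases "fib_inf r") (simp_all add: seg_Suc occurrences_Cons)

lemma block_letter_Suc:
  assumes "1 \<le> r"
  shows "fib_inf (Suc (block_start r)) = Lb \<longleftrightarrow> fib_inf r = La"
proof (cases "fib_inf r")
  case La
  then show ?thesis using sigma_seg_occurs[of r 1] assms by (simp add: seg_Suc occurrences_Cons)
next
  case Lb
  then show ?thesis using block_letter[of "Suc r"] assms by (simp add: block_start_Suc)
qed

lemma position_in_block:
  assumes "1 \<le> q"
  shows "\<exists>r\<ge>1. q = block_start r \<or> (q = Suc (block_start r) \<and> fib_inf r = La)"
  using assms
proof (induction q rule: dec_induct)
  case base
  show ?case by (metis One_nat_def block_start_1 order_refl)
next
  case (step q)
  then obtain r where r: "1 \<le> r" "q = block_start r \<or> (q = Suc (block_start r) \<and> fib_inf r = La)"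
    by blast
  show ?case
  proof (cases "q = block_start r \<and> fib_inf r = La")
    case True
    then show ?thesis using r(1) by blast
  next
    case False
    then have "Suc q = block_start (Suc r)"
      using r by (cases "fib_inf r") (auto simp: block_start_Suc)
    then show ?thesis using r(1) by (metis le_SucI)
  qed
qed

text \<open>Both blocks \<open>ab\<close> and \<open>a\<close> contain the letter \<open>a\<close> only as their first letter, so
  the cutting into blocks can be read off from the sequence locally.\<close>

lemma La_iff_block_start:
  assumes "1 \<le> q"
  shows "fib_inf q = La \<longleftrightarrow> (\<exists>r\<ge>1. q = block_start r)"
proof -
  obtain r where r: "1 \<le> r" "q = block_start r \<or> (q = Suc (block_start r) \<and> fib_inf r = La)"
    using position_in_block[OF assms] by blast
  then show ?thesis using block_letter block_letter_Suc by (metis letter.distinct(1))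
qed

lemma Lb_neighbours:
  assumes "1 \<le> q" "fib_inf q = Lb"
  shows "1 < q" "fib_inf (q - 1) = La" "fib_inf (Suc q) = La"
proof -
  obtain r where r: "1 \<le> r" "q = Suc (block_start r)" "fib_inf r = La"
    using position_in_block[OF assms(1)] assms(2) block_letter by fastforce
  then show "1 < q" "fib_inf (q - 1) = La" "fib_inf (Suc q) = La"
    using block_letter[of r] block_letter[of "Suc r"] by (auto simp: block_start_Suc)
qed

text \<open>If \<open>aa\<close> starts at \<open>q\<close>, then \<open>q\<close> is a block \<open>\<sigma>(b) = a\<close>; as \<open>bb\<close> is not a
  factor, the next block is \<open>\<sigma>(a) = ab\<close>.\<close>

lemma no_La_cube:
  assumes "1 \<le> q" "fib_inf q = La" "fib_inf (Suc q) = La"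
  shows "fib_inf (Suc (Suc q)) = Lb"
proof -
  obtain r where r: "1 \<le> r" "q = block_start r"
    using assms La_iff_block_start by blast
  then have b: "fib_inf r = Lb"
    using block_letter_Suc[of r] assms(3) by (cases "fib_inf r") auto
  then have "Suc q = block_start (Suc r)" using r by (simp add: block_start_Suc)
  then show ?thesis using block_letter_Suc[of "Suc r"] Lb_neighbours(3)[OF r(1) b] by simp
qed

text \<open>The desubstitution principle. The appended \<open>a\<close> makes decoding unambiguous: a block
  \<open>\<sigma>(b) = a\<close> at the end of \<open>\<sigma>(u)\<close> is distinguished from the beginning of \<open>ab\<close> by the
  \<open>a\<close> that follows.\<close>

lemma occurrences_sigma_La: "occurrences (sigma u @ [La]) = block_start ` occurrences u"
proof (intro equalityI subsetI)
  fix q assume "q \<in> block_start ` occurrences u"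
  then obtain r where r: "r \<in> occurrences u" "q = block_start r" by blast
  then have "1 \<le> r" "seg r (length u) = u" by (auto simp: in_occurrences)
  then have "block_start r + length (sigma u) = block_start (r + length u)"
    by (simp add: block_start_add)
  with r \<open>1 \<le> r\<close> show "q \<in> occurrences (sigma u @ [La])"
    by (simp add: occurrences_append sigma_occurs occurrences_Cons block_letter Suc_leI)
next
  have desub: "r \<in> occurrences u" if "1 \<le> r" "block_start r \<in> occurrences (sigma u @ [La])" for r
    using that
  proof (induction u arbitrary: r)
    case Nil then show ?case by simp
  next
    case (Cons x u)
    have start_La: "\<exists>z. sigma u @ [La] = La # z"
    proof (cases u)
      case (Cons y v) then show ?thesis by (cases y) auto
    qed simp
    have "fib_inf r = x"
    proof (cases x)
      case La then show ?thesis using Cons.prems block_letter_Suc[of r] by (simp add: occurrences_Cons)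
    next
      case Lb
      then have "fib_inf (Suc (block_start r)) = La"
        using Cons.prems start_La by (auto simp: occurrences_Cons)
      then show ?thesis using Lb block_letter_Suc[OF Cons.prems(1)] by (cases "fib_inf r") auto
    qed
    moreover have "Suc r \<in> occurrences u"
    proof (rule Cons.IH)
      show "block_start (Suc r) \<in> occurrences (sigma u @ [La])"
        using Cons.prems \<open>fib_inf r = x\<close> by (simp add: occurrences_append block_start_Suc add.assoc)
    qed simp
    ultimately show ?case using Cons.prems by (simp add: occurrences_Cons)
  qed
  fix q assume q: "q \<in> occurrences (sigma u @ [La])"
  then have "1 \<le> q" by (simp add: in_occurrences)
  have "fib_inf q = La"
  proof (cases u)
    case Nil then show ?thesis using q by (simp add: occurrences_Cons)
  next
    case (Cons y v) then show ?thesis using q by (cases y) (auto simp: occurrences_Cons)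
  qed
  then obtain r where "1 \<le> r" "q = block_start r" using La_iff_block_start \<open>1 \<le> q\<close> by blast
  then show "q \<in> block_start ` occurrences u" using desub q by blast
qed

section \<open>Central words\<close>

text \<open>The \<open>n\<close>-th central word is \<open>F\<^bsub>n+1\<^esub>\<close> without its last two letters. The recursive form
  is chosen to match \<open>occurrences_sigma_La\<close>.\<close>

primrec central :: "nat \<Rightarrow> word" where
  "central 0 = []"
| "central (Suc n) = sigma (central n) @ [La]"

lemma fib_word_eq_central:
  "fib_word (Suc n) = central n @ (if even n then [La, Lb] else [Lb, La])"
proof (induction n)
  case 0
  show ?case by (simp add: fib_word_Suc fib_word_0)
next
  case (Suc n)
  have "fib_word (Suc (Suc n)) = sigma (central n @ (if even n then [La, Lb] else [Lb, La]))"
    using Suc by (simp only: fib_word_Suc[of "Suc n"])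
  then show ?case by simp
qed

lemma length_central: "length (central n) + 2 = fib_len (Suc n)"
  using arg_cong[OF fib_word_eq_central[of n], of length] by (simp add: length_fib_word split: if_splits)

lemma central_occurs_first: "1 \<in> occurrences (central n)"
  by (rule prefix_occurs_first[of _ "Suc n"]) (simp add: fib_word_eq_central)

lemma prefix_central: "m \<le> n \<Longrightarrow> prefix (central m) (central n)"
  using occurs_first_unique[OF central_occurs_first central_occurs_first, of m n]
    length_central[of m] length_central[of n] fib_len_mono[of "Suc m" "Suc n"] by linarith

text \<open>Together with \<open>prefix_central\<close>, this makes each central word a border of the next one, which
  therefore has period \<open>f\<^sub>n\<close>.\<close>

lemma central_Suc: "central (Suc n) = fib_word n @ central n"
proof (induction n)
  case 0 show ?case by (simp add: fib_word_0)
next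
  case (Suc n)
  have "central (Suc (Suc n)) = sigma (fib_word n @ central n) @ [La]"
    using Suc by (simp only: central.simps)
  then show ?case by (simp add: fib_word_Suc)
qed

text \<open>The start of the \<open>p\<close>-th block when the sequence is cut into the blocks
  \<open>\<sigma>\<^sup>n(a)\<close> and \<open>\<sigma>\<^sup>n(b)\<close>.\<close>

definition power_start :: "nat \<Rightarrow> nat \<Rightarrow> nat" where
  "power_start n = (block_start ^^ n)"

lemma power_start_pos: "1 \<le> p \<Longrightarrow> 1 \<le> power_start n p"
  by (cases n) (simp_all add: power_start_def Suc_leI)

lemma power_start_occurs_and_add:
  assumes "1 \<le> p"
  shows "power_start n p \<in> occurrences ((sigma ^^ n) (seg p l)) \<and>
    power_start n (p + l) = power_start n p + length ((sigma ^^ n) (seg p l))"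
proof (induction n)
  case 0 show ?case using assms by (simp add: power_start_def in_occurrences)
next
  case (Suc n)
  let ?w = "(sigma ^^ n) (seg p l)"
  have "seg (power_start n p) (length ?w) = ?w" using Suc by (simp add: in_occurrences)
  then have "block_start (power_start n p + length ?w) = block_start (power_start n p) + length (sigma ?w)"
    using block_start_add[OF power_start_pos[OF assms]] by simp
  then show ?case using Suc sigma_occurs[of "power_start n p" ?w] by (simp add: power_start_def)
qed

text \<open>The length of \<open>\<sigma>\<^sup>n(b)\<close> is \<open>f\<^bsub>n-1\<^esub>\<close>, written with \<^const>\<open>fib\<close> so that it
  covers \<open>f\<^bsub>-1\<^esub> = 1\<close>.\<close>

lemma length_sigma_power:
  "length ((sigma ^^ n) [x]) = (if x = La then fib_len n else fib (Suc n))"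
proof (cases x)
  case La then show ?thesis using length_fib_word[of n] by (simp add: fib_word_def)
next
  case Lb
  show ?thesis
  proof (cases n)
    case (Suc m)
    then show ?thesis using Lb length_fib_word[of m]
      by (simp add: fib_word_def funpow_Suc_right fib_len_def del: funpow.simps)
  qed (simp add: Lb)
qed

lemma power_start_Suc:
  "1 \<le> p \<Longrightarrow> power_start n (Suc p) =
     power_start n p + (if fib_inf p = La then fib_len n else fib (Suc n))"
  using power_start_occurs_and_add[of p n 1] by (simp add: seg_Suc length_sigma_power)

lemma occurrences_central: "occurrences (central n) = power_start n ` {1..}"
proof (induction n)
  case 0 show ?case by (auto simp: power_start_def)
next
  case (Suc n)
  then show ?case by (simp add: occurrences_sigma_La power_start_def image_comp)
qed

text \<open>A cut of \<open>\<sigma>(v)a\<close> in front of a letter \<open>a\<close> falls between two blocks.\<close>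

lemma split_sigma_at_La:
  "sigma v @ [La] = x @ La # z \<Longrightarrow>
     \<exists>v1 v2. v = v1 @ v2 \<and> x = sigma v1 \<and> La # z = sigma v2 @ [La]"
proof (induction v arbitrary: x)
  case Nil
  then have "x = []" "z = []" by (cases x; simp)+
  then show ?case by simp
next
  case (Cons y v)
  show ?case
  proof (cases "x = []")
    case True
    then show ?thesis using Cons.prems by (intro exI[of _ "[]"] exI[of _ "y # v"]) simp
  next
    case False
    then obtain x' where x': "x = sigma_letter y @ x'"
      using Cons.prems by (cases y) (auto simp: Cons_eq_append_conv)
    then have "sigma v @ [La] = x' @ La # z" using Cons.prems by simp
    then obtain v1 v2 where "v = v1 @ v2" "x' = sigma v1" "La # z = sigma v2 @ [La]"
      using Cons.IH by blast
    then show ?thesis using x' by (intro exI[of _ "y # v1"] exI[of _ v2]) simp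
  qed
qed

text \<open>A \<open>b\<close> is always preceded and followed by \<open>a\<close>. Hence a factor can be extended, without
  losing occurrences, to one that begins and ends with \<open>a\<close>; such a word has the form
  \<open>\<sigma>(u)a\<close>. As a central word of positive index begins and ends with \<open>a\<close> itself, the
  extension does not leave it.\<close>

lemma pad_left:
  assumes "w \<noteq> []" "central n = X @ w @ Y"
  obtains X' x0 z where "X = X' @ x0" "x0 @ w = La # z"
    "\<forall>q\<in>occurrences w. \<exists>q'\<in>occurrences (x0 @ w). q = q' + length x0"
proof (cases "hd w")
  case La
  then show ?thesis using that[of X "[]" "tl w"] assms(1) by (cases w) auto
next
  case Lb
  then obtain z where z: "w = Lb # z" using assms(1) by (cases w) auto
  have before: "1 < q \<and> q - 1 \<in> occurrences [La]" if q: "q \<in> occurrences w" for q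
  proof -
    have "1 \<le> q" "fib_inf q = Lb" using q z by (auto simp: occurrences_Cons)
    then show ?thesis using Lb_neighbours[of q] by (auto simp: occurrences_Cons)
  qed
  have X: "1 \<in> occurrences X" "1 + length X \<in> occurrences w"
    using central_occurs_first[of n] assms(2) by (simp_all add: occurrences_append)
  then have "X \<noteq> []" using before by fastforce
  then obtain X' c where Xc: "X = X' @ [c]" by (metis rev_exhaust)
  then have "c = La"
    using X(1) before[OF X(2)] by (auto simp: occurrences_append occurrences_Cons)
  show ?thesis
  proof (rule that[of X' "[La]" w])
    show "X = X' @ [La]" using Xc \<open>c = La\<close> by simp
    show "\<forall>q\<in>occurrences w. \<exists>q'\<in>occurrences ([La] @ w). q = q' + length [La]"
    proof
      fix q assume q: "q \<in> occurrences w"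
      then show "\<exists>q'\<in>occurrences ([La] @ w). q = q' + length [La]"
        using before[OF q] by (intro bexI[of _ "q - 1"]) (auto simp: occurrences_Cons)
    qed
  qed simp
qed

lemma pad_right:
  assumes "w \<noteq> []" "central (Suc n) = X @ w @ Y"
  obtains y0 Y' z where "Y = y0 @ Y'" "w @ y0 = z @ [La]"
    "\<forall>q\<in>occurrences w. q \<in> occurrences (w @ y0)"
proof -
  obtain v c where w: "w = v @ [c]" using assms(1) by (metis rev_exhaust)
  show ?thesis
  proof (cases c)
    case La
    then show ?thesis using that[of "[]" Y v] w by auto
  next
    case Lb
    have after: "q + length w \<in> occurrences [La]" if q: "q \<in> occurrences w" for q
    proof -
      have "1 \<le> q + length v" "fib_inf (q + length v) = Lb"
        using q w Lb by (auto simp: occurrences_append occurrences_Cons)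
      then show ?thesis using Lb_neighbours(3)[of "q + length v"] w by (auto simp: occurrences_Cons)
    qed
    have "Y \<noteq> []"
    proof
      assume "Y = []"
      then have "last (central (Suc n)) = Lb" using assms(2) w Lb by simp
      then show False by simp
    qed
    then obtain d Y' where Y: "Y = d # Y'" by (cases Y) auto
    have "1 + length X \<in> occurrences w" "1 + length X + length w \<in> occurrences (d # Y')"
      using central_occurs_first[of "Suc n"] unfolding assms(2) Y
      by (simp_all add: occurrences_append add.assoc)
    then have "d = La" using after by (fastforce simp: occurrences_Cons)
    then show ?thesis using that[of "[La]" Y' w] Y after by (auto simp: occurrences_append)
  qed
qed

lemma sigma_La_starts_La: "\<exists>t. sigma v @ [La] = La # t"
proof (cases v)
  case (Cons y u) then show ?thesis by (cases y) auto
qed simp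

text \<open>Induction on \<open>n\<close>: pad \<open>w\<close> by letters \<open>a\<close> to a word \<open>\<sigma>(u)a\<close>. Then \<open>u\<close> is a factor
  of the central word of index \<open>n - 1\<close> and of no earlier one, since otherwise \<open>w\<close> would already
  be a factor of an earlier central word than \<open>n\<close>. The occurrences of \<open>\<sigma>(u)a\<close> are the
  images of those of \<open>u\<close>, and a prefix \<open>x\<close> in front of \<open>u\<close> becomes \<open>\<sigma>(x)\<close>.\<close>

lemma occurs_only_inside_central:
  assumes "sublist w (central n)" "\<And>m. m < n \<Longrightarrow> \<not> sublist w (central m)"
  shows "\<exists>x y. central n = x @ w @ y \<and>
    (\<forall>q\<in>occurrences w. \<exists>r\<in>occurrences (central n). q = r + length x)"
  using assms
proof (induction n arbitrary: w)
  case 0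
  then show ?case by auto
next
  case (Suc n)
  have "w \<noteq> []" using Suc.prems(2)[of 0] by auto
  obtain X Y where XY: "central (Suc n) = X @ w @ Y" using Suc.prems(1) by (auto simp: sublist_def)
  obtain X' x0 z where left: "X = X' @ x0" "x0 @ w = La # z"
    "\<forall>q\<in>occurrences w. \<exists>q'\<in>occurrences (x0 @ w). q = q' + length x0"
    using pad_left[OF \<open>w \<noteq> []\<close> XY] by metis
  have ne: "x0 @ w \<noteq> []" and XY': "central (Suc n) = X' @ (x0 @ w) @ Y"
    using XY left(1) \<open>w \<noteq> []\<close> by simp_all
  obtain y0 Y' z' where right: "Y = y0 @ Y'" "(x0 @ w) @ y0 = z' @ [La]"
    "\<forall>q\<in>occurrences (x0 @ w). q \<in> occurrences ((x0 @ w) @ y0)"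
    using pad_right[OF ne XY'] by metis
  have "sigma (central n) @ [La] = X' @ La # (z @ Y)"
    using XY' left(2) by (metis append_Cons central.simps(2))
  then obtain v1 v2 where v: "central n = v1 @ v2" "X' = sigma v1" "La # (z @ Y) = sigma v2 @ [La]"
    using split_sigma_at_La by blast
  have "La # (z @ Y) = ((x0 @ w) @ y0) @ Y'" using left(2) right(1) by (metis append.assoc append_Cons)
  then have "sigma v2 @ [La] = (z' @ [La]) @ Y'" unfolding v(3) right(2) .
  then have "sigma v2 @ [La] = z' @ La # Y'" by simp
  then obtain u v3 where u: "v2 = u @ v3" "z' = sigma u" using split_sigma_at_La by blast
  have padded: "x0 @ w @ y0 = sigma u @ [La]" using right(2) u(2) by simp
  \<comment> \<open>Whatever surrounds \<open>u\<close> in a central word yields surroundings of the padded word in the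
    next central word: \<open>\<sigma>(t)a\<close> begins with the final \<open>a\<close> of \<open>\<sigma>(u)a\<close>.\<close>
  have lift: "\<exists>t. central (Suc m) = sigma s @ x0 @ w @ y0 @ t" if m: "central m = s @ u @ t" for m s t
  proof -
    obtain t' where "sigma t @ [La] = La # t'" using sigma_La_starts_La by blast
    then have "central (Suc m) = sigma s @ (sigma u @ [La]) @ t'" using m by simp
    then show ?thesis unfolding padded[symmetric] by (metis append.assoc)
  qed
  have "sublist u (central n)" using v(1) u(1) by (auto simp: sublist_def)
  moreover have "\<not> sublist u (central m)" if "m < n" for m
  proof
    assume "sublist u (central m)"
    then obtain s t where "central m = s @ u @ t" by (auto simp: sublist_def)
    then obtain t' where "central (Suc m) = (sigma s @ x0) @ w @ (y0 @ t')"
      using lift by (metis append.assoc)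
    then have "sublist w (central (Suc m))" by (metis sublist_appendI)
    then show False using Suc.prems(2)[of "Suc m"] that by simp
  qed
  ultimately obtain x y where x: "central n = x @ u @ y"
    "\<And>q. q \<in> occurrences u \<Longrightarrow> \<exists>r\<in>occurrences (central n). q = r + length x"
    using Suc.IH[of u] by blast
  obtain t where t: "central (Suc n) = (sigma x @ x0) @ w @ (y0 @ t)"
    using lift[OF x(1)] by (metis append.assoc)
  have "\<exists>r\<in>occurrences (central (Suc n)). q = r + length (sigma x @ x0)" if q: "q \<in> occurrences w" for q
  proof -
    obtain q' where q': "q' \<in> occurrences (x0 @ w)" "q = q' + length x0" using left(3) q by blast
    have "q' \<in> block_start ` occurrences u"
      using right(3) q'(1) padded occurrences_sigma_La[of u] by simp
    then obtain r where r: "r \<in> occurrences u" "q' = block_start r" by blast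
    obtain r1 where r1: "r1 \<in> occurrences (central n)" "r = r1 + length x" using x(2)[OF r(1)] by blast
    have "1 \<le> r1" "seg r1 (length x) = x"
      using r1(1) unfolding x(1) occurrences_append by (auto simp: in_occurrences)
    then have "q' = block_start r1 + length (sigma x)" using block_start_add r(2) r1(2) by simp
    moreover have "block_start r1 \<in> occurrences (central (Suc n))"
      using r1(1) by (simp add: occurrences_sigma_La)
    ultimately show ?thesis using q'(2) by (intro bexI) simp_all
  qed
  then show ?case using t by blast
qed

lemma factor_sublist_central:
  assumes "q \<in> occurrences w"
  shows "\<exists>n. sublist w (central n)"
proof -
  let ?l = "q - 1 + length w"
  have "seg 1 ?l = seg 1 (q - 1) @ w"
    using assms seg_add[of 1 "q - 1" "length w"] by (auto simp: in_occurrences)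
  then obtain z where "fib_word ?l = seg 1 (q - 1) @ w @ z"
    using initial_seg_prefix_fib_word[of ?l] by (auto simp: prefix_def)
  then have "central (Suc ?l) = seg 1 (q - 1) @ w @ z @ central ?l"
    using central_Suc[of ?l] by simp
  then show ?thesis by (metis sublist_appendI)
qed

section \<open>Singular words\<close>

lemma last_fib_word: "last (fib_word k) = (if even k then La else Lb)"
proof (cases k)
  case 0 then show ?thesis by (simp add: fib_word_0)
next
  case (Suc n) then show ?thesis by (simp add: fib_word_eq_central)
qed

lemma fib_word_snoc: "fib_word k = butlast (fib_word k) @ [last (fib_word k)]"
  using fib_word_nonempty[of k] by simp

lemma singular_Suc:
  "singular (int (Suc k) - 1) = other_letter (last (fib_word k)) # butlast (fib_word k)"
  by (simp add: singular_def)

lemma length_singular: "length (singular (int n - 1)) = fib (Suc n)"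
proof (cases n)
  case 0 then show ?thesis by (simp add: singular_def)
next
  case (Suc k) then show ?thesis
    using fib_len_pos[of k] by (simp add: singular_def length_fib_word fib_len_def)
qed

text \<open>Writing the index as \<open>int n - 1\<close> with \<open>n\<close> a natural number treats the exceptional word
  \<open>s\<^bsub>-1\<^esub> = a\<close> on the same footing as the others. For \<open>n = k + 1\<close> the central word begins with
  \<open>F\<^bsub>k+1\<^esub>F\<^sub>k\<close>, and the last letters of these two Fibonacci words differ; so the last letter of
  \<open>F\<^bsub>k+1\<^esub>\<close> and \<open>F\<^sub>k\<close> without its last letter form \<open>s\<^sub>k\<close>.\<close>

lemma central_Suc_eq_singular:
  "\<exists>z. central (Suc n) = butlast (fib_word n) @ singular (int n - 1) @ z"
proof (cases n)
  case 0 then show ?thesis by (simp add: fib_word_0 singular_def)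
next
  case (Suc k)
  have last: "last (fib_word (Suc k)) = other_letter (last (fib_word k))"
    by (simp add: last_fib_word)
  have "central (Suc n) = fib_word (Suc k) @ fib_word k @ central k"
    using Suc central_Suc[of "Suc k"] central_Suc[of k] by (simp only: )
  also have "\<dots> = (butlast (fib_word (Suc k)) @ [last (fib_word (Suc k))]) @
      (butlast (fib_word k) @ [last (fib_word k)]) @ central k"
    using fib_word_snoc by presburger
  finally show ?thesis unfolding Suc singular_Suc last by auto
qed

text \<open>Let \<open>n = m + 1\<close> and \<open>c\<^sub>n = X s\<^sub>m Y\<close>. Now \<open>c\<^sub>n = F\<^sub>m c\<^sub>m\<close>, where \<open>c\<^sub>m\<close> is a
  prefix of \<open>c\<^sub>n\<close>, so that \<open>X\<close> is a prefix of \<open>c\<^sub>m\<close> and \<open>X s\<^sub>m = F\<^sub>m X\<close> by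
  comparing lengths. Then \<open>s\<^sub>m\<close> and \<open>F\<^sub>m\<close> have the same letters, contrary to the
  definition of \<open>s\<^sub>m\<close>.\<close>

lemma singular_not_in_central: "\<not> sublist (singular (int n - 1)) (central n)"
proof (cases n)
  case 0 then show ?thesis by (simp add: singular_def)
next
  case (Suc m)
  let ?F = "fib_word m" and ?s = "singular (int (Suc m) - 1)"
  have "\<not> sublist ?s (central (Suc m))"
  proof
    assume "sublist ?s (central (Suc m))"
    then obtain X Y where XY: "central (Suc m) = X @ ?s @ Y" unfolding sublist_def by blast
    have len: "length ?s = length ?F"
      by (simp only: length_singular length_fib_word fib_len_def add_2_eq_Suc')
    have eq: "X @ ?s @ Y = ?F @ central m" using XY unfolding central_Suc by (rule sym)
    have "length X + (length ?s + length Y) = length ?F + length (central m)"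
      using arg_cong[OF eq, of length] by (simp only: length_append)
    then have "length X \<le> length (central m)" using len by linarith
    have "prefix X (central m)"
    proof (rule prefix_length_prefix)
      show "prefix X (central (Suc m))" using XY by (rule prefixI)
      show "prefix (central m) (central (Suc m))" by (rule prefix_central) simp
    qed fact
    then obtain t where t: "central m = X @ t" by (auto simp: prefix_def)
    have "(X @ ?s) @ Y = (?F @ X) @ t" using eq unfolding t append.assoc .
    then have "X @ ?s = ?F @ X" using len by (subst (asm) append_eq_append_conv) simp_all
    then have "mset (X @ ?s) = mset (?F @ X)" by (rule arg_cong)
    then have "mset ?s = mset ?F" unfolding mset_append union_commute[of "mset ?F"] by simp
    also have "mset ?F = mset (butlast ?F @ [last ?F])" by (rule arg_cong[OF fib_word_snoc])
    finally have "other_letter (last ?F) = last ?F" unfolding singular_Suc by simp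
    then show False by (cases "last ?F") auto
  qed
  then show ?thesis unfolding Suc .
qed

text \<open>If \<open>w\<close> began after the first \<open>f\<^sub>n\<close> letters, it would lie in the suffix
  \<open>c\<^sub>n\<close> of \<open>c\<^bsub>n+1\<^esub>\<close>; if it ended within the first \<open>|c\<^sub>n|\<close> letters, it would
  lie in the prefix \<open>c\<^sub>n\<close>. So it covers all positions in between, and these carry the singular
  word by \<open>central_Suc_eq_singular\<close>.\<close>

lemma singular_in_factor:
  assumes "sublist w (central (Suc n))" "\<not> sublist w (central n)"
  shows "sublist (singular (int n - 1)) w"
proof -
  let ?D = "butlast (fib_word n)" and ?s = "singular (int n - 1)"
  obtain X Y where XY: "central (Suc n) = X @ w @ Y" using assms(1) by (auto simp: sublist_def)
  obtain z where z: "central (Suc n) = ?D @ ?s @ z" using central_Suc_eq_singular by blast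
  have lenD: "length ?D + 1 = length (fib_word n)"
    using fib_word_nonempty[of n] by (cases "fib_word n" rule: rev_cases) auto
  have lenDs: "length (?D @ ?s) = length (central n) + 1"
    using lenD length_central[of n] by (simp add: length_singular length_fib_word fib_len_def)
  have pre: "prefix X (central (Suc n))" "prefix (X @ w) (central (Suc n))"
    "prefix ?D (central (Suc n))" "prefix (?D @ ?s) (central (Suc n))"
    "prefix (fib_word n) (central (Suc n))"
    using XY z central_Suc[of n] by (metis append.assoc prefixI)+
  have "length X < length (fib_word n)"
  proof (rule ccontr)
    assume "\<not> ?thesis"
    then have "prefix (fib_word n) X" using prefix_length_prefix[OF pre(5) pre(1)] by simp
    then obtain t where "X = fib_word n @ t" by (auto simp: prefix_def)
    then have "central n = t @ w @ Y" using XY central_Suc[of n] by simp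
    then show False using assms(2) by (metis sublist_appendI)
  qed
  then have "prefix X ?D" using lenD prefix_length_prefix[OF pre(1) pre(3)] by simp
  then obtain d where d: "?D = X @ d" by (auto simp: prefix_def)
  have "length (central n) < length (X @ w)"
  proof (rule ccontr)
    assume "\<not> ?thesis"
    then have "prefix (X @ w) (central n)"
      using prefix_length_prefix[OF pre(2) prefix_central[of n "Suc n"]] by simp
    then obtain t where "central n = X @ w @ t" by (auto simp: prefix_def)
    then show False using assms(2) by (metis sublist_appendI)
  qed
  then have "prefix (?D @ ?s) (X @ w)"
    using lenDs prefix_length_prefix[OF pre(4) pre(2)] by simp
  then show ?thesis unfolding d by (auto simp: prefix_def)
qed

lemma singular_words_eq: "singular_words = range (\<lambda>n. singular (int n - 1))"
proof -
  have "\<exists>n. k = int n - 1" if "-1 \<le> k" for k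
    using that by (intro exI[of _ "nat (k + 1)"]) simp
  then show ?thesis by (force simp: singular_words_def)
qed

lemma fib_Suc_less: "m < n \<Longrightarrow> 2 \<le> n \<Longrightarrow> fib (Suc m) < fib (Suc n)"
proof -
  assume mn: "m < n" and n: "2 \<le> n"
  obtain k where k: "n = Suc (Suc k)" using n by (metis add_2_eq_Suc le_Suc_ex)
  have "fib (Suc m) \<le> fib (Suc (Suc k))" using mn k by (intro fib_mono) simp
  also have "\<dots> < fib (Suc n)" using k fib_len_less_Suc[of k] by (simp add: fib_len_def)
  finally show ?thesis .
qed

lemma singular_inj:
  assumes "singular (int m - 1) = singular (int n - 1)"
  shows "m = n"
proof -
  have False if eq: "singular (int i - 1) = singular (int j - 1)" and "i < j" for i j
  proof (cases "2 \<le> j")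
    case True
    then show False using fib_Suc_less[OF \<open>i < j\<close>] eq length_singular[of i] length_singular[of j] by simp
  next
    case False
    then have "i = 0" "j = 1" using \<open>i < j\<close> by simp_all
    then show False using eq by (simp add: singular_def fib_word_0)
  qed
  then show ?thesis using assms by (metis nat_neq_iff)
qed

text \<open>The lengths of the singular words are strictly increasing except that \<open>s\<^bsub>-1\<^esub> = a\<close> and
  \<open>s\<^sub>0 = b\<close> both have length 1. This tie concerns only factors of \<open>aba\<close> that contain both
  letters, and these are the words excluded from the admissible ones.\<close>

lemma singular_kernel_eq:
  assumes adm: "w \<in> admissible_factors"
    and w: "sublist w (central (Suc K))" "\<not> sublist w (central K)"
  shows "singular_kernel w = singular (int K - 1)"
proof -
  have sK: "sublist (singular (int K - 1)) w" using singular_in_factor[OF w] .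
  have le: "m \<le> K" if "sublist (singular (int m - 1)) w" for m
  proof (rule ccontr)
    assume "\<not> m \<le> K"
    then have "sublist (central (Suc K)) (central m)"
      using prefix_central[of "Suc K" m] by (simp add: prefix_imp_sublist)
    then show False using that w(1) singular_not_in_central[of m] sublist_order.order.trans by blast
  qed
  show ?thesis unfolding singular_kernel_def
  proof (rule the_equality)
    show "singular (int K - 1) \<in> singular_words \<and> sublist (singular (int K - 1)) w \<and>
      (\<forall>t\<in>singular_words. sublist t w \<longrightarrow> length t \<le> length (singular (int K - 1)))"
      using sK le by (auto simp: singular_words_eq length_singular intro!: fib_mono)
  next
    fix s
    assume s: "s \<in> singular_words \<and> sublist s w \<and> (\<forall>t\<in>singular_words. sublist t w \<longrightarrow> length t \<le> length s)"
    then obtain m where m: "s = singular (int m - 1)" by (auto simp: singular_words_eq)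
    have "m \<le> K" using le s m by blast
    have long: "fib (Suc K) \<le> fib (Suc m)"
      using s sK m by (metis length_singular rangeI singular_words_eq)
    show "s = singular (int K - 1)"
    proof (rule ccontr)
      assume "s \<noteq> singular (int K - 1)"
      then have "m < K" using \<open>m \<le> K\<close> m by (cases "m = K") auto
      then have "K = 1" "m = 0" using long fib_Suc_less[of m K] by (cases "2 \<le> K"; simp)+
      then have "sublist w [La, Lb, La]" "sublist [La] w" "sublist [Lb] w"
        using w(1) s m sK by (simp_all add: singular_def fib_word_0 numeral_2_eq_2)
      then have "w \<in> {[La, Lb], [Lb, La], [La, Lb, La]}"
        by (auto simp: sublist_Cons_right prefix_Cons)
      then show False using adm by (auto simp: admissible_factors_def)
    qed
  qed
qed

section \<open>Gaps between consecutive occurrences\<close>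

lemma enumerate_range_strict_mono:
  fixes f :: "nat \<Rightarrow> nat"
  assumes "strict_mono f"
  shows "enumerate (range f) i = f i"
proof (induction i)
  case 0
  show ?case unfolding enumerate_0
    using assms by (intro Least_equality) (auto simp: strict_mono_less_eq)
next
  case (Suc i)
  have inf: "infinite (range f)"
    using assms by (simp add: range_inj_infinite strict_mono_imp_inj_on)
  show ?case unfolding enumerate_Suc''[OF inf] Suc
    using assms by (intro Least_equality) (auto simp: strict_mono_less_eq strict_mono_less)
qed

lemma power_start_strict_mono: "strict_mono (\<lambda>i. power_start n (Suc i) + c)"
  unfolding strict_mono_Suc_iff
  using fib_len_pos[of n] by (simp add: power_start_Suc fib_neq_0_nat)

text \<open>The kernel is \<open>s\<^bsub>K-1\<^esub>\<close> when \<open>K + 1\<close> is the least index of a central word that contains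
  \<open>w\<close>; the gaps are the lengths of the blocks of order \<open>K + 1\<close>.\<close>

lemma kernel_and_gaps:
  assumes "w \<in> admissible_factors"
  shows "\<exists>K. singular_kernel w = singular (int K - 1) \<and>
    (\<forall>p\<ge>1. occ w (Suc p) = occ w p + (if fib_inf p = La then fib_len (Suc K) else fib_len K))"
proof -
  have "\<exists>n. sublist w (central n)" and "w \<noteq> []"
    using assms factor_sublist_central by (auto simp: admissible_factors_def)
  define n where "n = (LEAST n. sublist w (central n))"
  have n: "sublist w (central n)" "\<And>m. m < n \<Longrightarrow> \<not> sublist w (central m)"
    unfolding n_def using \<open>\<exists>n. sublist w (central n)\<close> by (auto intro: LeastI_ex dest: not_less_Least)
  obtain K where K: "n = Suc K" using n(1) \<open>w \<noteq> []\<close> by (cases n) auto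
  obtain x y where x: "central n = x @ w @ y"
    "\<And>q. q \<in> occurrences w \<Longrightarrow> \<exists>r\<in>occurrences (central n). q = r + length x"
    using occurs_only_inside_central[OF n] by blast
  have "occurrences w = (\<lambda>r. r + length x) ` occurrences (central n)"
    using x(2) unfolding x(1) by (auto simp: occurrences_append)
  also have "\<dots> = range (\<lambda>i. power_start n (Suc i) + length x)"
    unfolding occurrences_central image_image atLeast_Suc_greaterThan[symmetric]
    by (auto simp: image_iff) (metis Suc_le_D One_nat_def)
  finally have occ: "occ w p = power_start n p + length x" if "1 \<le> p" for p
    using that enumerate_range_strict_mono[OF power_start_strict_mono[of n "length x"]]
    by (simp add: occ_def)
  have "occ w (Suc p) = occ w p + (if fib_inf p = La then fib_len (Suc K) else fib_len K)"
    if "1 \<le> p" for p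
    using that by (simp add: occ power_start_Suc K fib_len_def)
  moreover have "singular_kernel w = singular (int K - 1)"
    using singular_kernel_eq[OF assms] n K by blast
  ultimately show ?thesis by blast
qed

section \<open>The spectrum\<close>

text \<open>For a word with kernel \<open>s\<^bsub>K-1\<^esub>\<close>, the index \<open>k\<close> in the definition of T1.2 has to be \<open>K\<close>,
  and that in the definition of T1.3 has to be \<open>K + 1\<close>. The lengths that these types prescribe are
  thus exactly the two gaps of \<open>kernel_and_gaps\<close>.\<close>

lemma T1_2_iff:
  assumes "w \<in> admissible_factors" "singular_kernel w = singular (int K - 1)"
  shows "w \<in> T1 2 \<longleftrightarrow> length w = fib_len K"
proof
  assume "w \<in> T1 2"
  then obtain k where k: "length w = fib_len k" "singular_kernel w = singular (int k - 1)"
    by (auto simp: T1_def)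
  then show "length w = fib_len K" using assms(2) singular_inj[of k K] by simp
next
  assume "length w = fib_len K"
  then show "w \<in> T1 2" using assms fib_len_less_Suc[of K] by (auto simp: T1_def intro!: exI[of _ K])
qed

lemma T1_3_iff:
  assumes "w \<in> admissible_factors" "singular_kernel w = singular (int K - 1)"
  shows "w \<in> T1 3 \<longleftrightarrow> length w = fib_len (Suc K)"
proof
  assume "w \<in> T1 3"
  then obtain k where k: "length w = fib_len k" "1 \<le> k" "singular_kernel w = singular (int k - 3 + 1)"
    by (auto simp: T1_def)
  obtain m where m: "k = Suc m" using k(2) by (cases k) auto
  then have "singular (int m - 1) = singular (int K - 1)" using k(3) assms(2) by simp
  then show "length w = fib_len (Suc K)" using k(1) m singular_inj by blast
next
  assume "length w = fib_len (Suc K)"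
  then show "w \<in> T1 3"
    using assms fib_len_less_Suc[of "Suc K"] by (auto simp: T1_def intro!: exI[of _ "Suc K"])
qed

lemma T1_admissible: "w \<in> T1 j \<Longrightarrow> w \<in> admissible_factors"
  by (simp add: T1_def)

lemma T1_2_3_disjoint: "w \<in> T1 2 \<Longrightarrow> w \<notin> T1 3"
proof -
  assume w: "w \<in> T1 2"
  then have adm: "w \<in> admissible_factors" by (rule T1_admissible)
  from kernel_and_gaps[OF adm] obtain K where "singular_kernel w = singular (int K - 1)" by blast
  then show ?thesis using w T1_2_iff[OF adm] T1_3_iff[OF adm] fib_len_less_Suc[of K] by auto
qed

lemma adjacent_iff:
  assumes adm: "w \<in> admissible_factors" and "1 \<le> p"
  shows "occ w (Suc p) = occ w p + length w \<longleftrightarrow>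
    (w \<in> T1 2 \<and> fib_inf p = Lb) \<or> (w \<in> T1 3 \<and> fib_inf p = La)"
proof -
  obtain K where K: "singular_kernel w = singular (int K - 1)"
    and gap: "\<forall>p\<ge>1. occ w (Suc p) = occ w p + (if fib_inf p = La then fib_len (Suc K) else fib_len K)"
    using kernel_and_gaps[OF adm] by blast
  have "occ w (Suc p) = occ w p + (if fib_inf p = La then fib_len (Suc K) else fib_len K)"
    using gap \<open>1 \<le> p\<close> by blast
  then show ?thesis
    using T1_2_iff[OF adm K] T1_3_iff[OF adm K] by (cases "fib_inf p") auto
qed

lemma power_property_Suc:
  "power_property (Suc i) w p \<longleftrightarrow>
     power_property i w p \<and> occ w (Suc (p + i)) = occ w (p + i) + length w"
  by (auto simp: power_property_def less_Suc_eq)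

lemma power_property_0: "power_property 0 w p"
  by (simp add: power_property_def)

lemma power_property_1_iff:
  assumes "w \<in> admissible_factors" "1 \<le> p"
  shows "power_property 1 w p \<longleftrightarrow>
    (w \<in> T1 2 \<and> fib_inf p = Lb) \<or> (w \<in> T1 3 \<and> fib_inf p = La)"
  using adjacent_iff[OF assms] by (simp add: power_property_Suc power_property_0)

text \<open>Two adjacent gaps have the same length only if the letters at \<open>p\<close> and \<open>p + 1\<close> agree,
  because a word is not of both types; and they cannot both be \<open>b\<close>.\<close>

lemma power_property_2_iff:
  assumes "w \<in> admissible_factors" "1 \<le> p"
  shows "power_property 2 w p \<longleftrightarrow> w \<in> T1 3 \<and> fib_inf p = La \<and> fib_inf (Suc p) = La"
proof -
  have "power_property 2 w p \<longleftrightarrow> power_property 1 w p \<and> occ w (Suc (Suc p)) = occ w (Suc p) + length w"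
    using power_property_Suc[of 1 w p] by (simp add: numeral_2_eq_2)
  also have "\<dots> \<longleftrightarrow> w \<in> T1 3 \<and> fib_inf p = La \<and> fib_inf (Suc p) = La"
    using adjacent_iff[OF assms(1), of "Suc p"] power_property_1_iff[OF assms]
      T1_2_3_disjoint[of w] Lb_neighbours(3)[OF assms(2)] by auto
  finally show ?thesis .
qed

lemma not_power_property_3:
  assumes "w \<in> admissible_factors" "1 \<le> p" "3 \<le> i"
  shows "\<not> power_property i w p"
proof
  assume i: "power_property i w p"
  have mono: "power_property j w p" if "j \<le> i" for j
    using i that by (simp add: power_property_def)
  have "power_property 2 w p" using mono assms(3) by simp
  then have w: "w \<in> T1 3" "fib_inf p = La" "fib_inf (Suc p) = La"
    using power_property_2_iff[OF assms(1,2)] by simp_all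
  have "power_property (Suc 2) w p" using mono assms(3) by simp
  then have "occ w (Suc (p + 2)) = occ w (p + 2) + length w"
    unfolding power_property_Suc by simp
  then have "fib_inf (p + 2) = La"
    using adjacent_iff[OF assms(1), of "p + 2"] T1_2_3_disjoint[of w] w(1) by auto
  then show False using no_La_cube[OF assms(2) w(2,3)] by simp
qed

theorem proposition6p3:
  shows "(spectrum (power_property 1) = (T1 2 \<times> Gamma_b) \<union> (T1 3 \<times> Gamma_a)
          \<and> (T1 2 \<times> Gamma_b) \<inter> (T1 3 \<times> Gamma_a) = {})
    \<and> spectrum (power_property 2) = T1 3 \<times> Gamma_aa
    \<and> (spectrum (power_property 1) - spectrum (power_property 2)
            = (T1 2 \<times> Gamma_b) \<union> (T1 3 \<times> Gamma_ab)
          \<and> (T1 2 \<times> Gamma_b) \<inter> (T1 3 \<times> Gamma_ab) = {})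
    \<and> (\<forall>i\<ge>3. spectrum (power_property i) = {})"
proof -
  have P1: "spectrum (power_property 1) = (T1 2 \<times> Gamma_b) \<union> (T1 3 \<times> Gamma_a)"
  proof (rule set_eqI)
    fix wp :: "word \<times> nat"
    obtain w p where wp: "wp = (w, p)" by (cases wp)
    show "wp \<in> spectrum (power_property 1) \<longleftrightarrow> wp \<in> (T1 2 \<times> Gamma_b) \<union> (T1 3 \<times> Gamma_a)"
    proof (cases "w \<in> admissible_factors \<and> 1 \<le> p")
      case True
      then show ?thesis
        using power_property_1_iff[of w p] by (auto simp: wp spectrum_def Gamma_a_def Gamma_b_def)
    next
      case False
      then show ?thesis
        using T1_admissible[of w] by (auto simp: wp spectrum_def Gamma_a_def Gamma_b_def)
    qed
  qed
  have P2: "spectrum (power_property 2) = T1 3 \<times> Gamma_aa"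
  proof (rule set_eqI)
    fix wp :: "word \<times> nat"
    obtain w p where wp: "wp = (w, p)" by (cases wp)
    show "wp \<in> spectrum (power_property 2) \<longleftrightarrow> wp \<in> T1 3 \<times> Gamma_aa"
    proof (cases "w \<in> admissible_factors \<and> 1 \<le> p")
      case True
      then show ?thesis
        using power_property_2_iff[of w p] by (auto simp: wp spectrum_def Gamma_aa_def)
    next
      case False
      then show ?thesis using T1_admissible[of w 3] by (auto simp: wp spectrum_def Gamma_aa_def)
    qed
  qed
  have letters: "Gamma_a \<inter> Gamma_b = {}" "Gamma_ab \<inter> Gamma_b = {}"
    by (auto simp: Gamma_a_def Gamma_b_def Gamma_ab_def)
  have "c = La \<or> c = Lb" for c by (cases c) auto
  then have split: "Gamma_a = Gamma_aa \<union> Gamma_ab" "Gamma_aa \<inter> Gamma_ab = {}" "Gamma_aa \<inter> Gamma_b = {}"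
    by (auto simp: Gamma_a_def Gamma_b_def Gamma_aa_def Gamma_ab_def)
  have "spectrum (power_property 1) - spectrum (power_property 2)
      = (T1 2 \<times> Gamma_b) \<union> (T1 3 \<times> Gamma_ab)"
    unfolding P1 P2 using split by blast
  moreover have "\<forall>i\<ge>3. spectrum (power_property i) = {}"
    using not_power_property_3 by (auto simp: spectrum_def)
  moreover have "(T1 2 \<times> Gamma_b) \<inter> (T1 3 \<times> Gamma_a) = {}" "(T1 2 \<times> Gamma_b) \<inter> (T1 3 \<times> Gamma_ab) = {}"
    using letters by blast+
  ultimately show ?thesis using P1 P2 by simp
qed

end
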